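(* Let $\gamma\in(0,1)$ and $\mathcal{N}_\gamma=\{z\in\mathbb{C}: d(z,[0,1])<\gamma\}$. There is a constant $C=C_\gamma>0$ depending only on $\gamma$ such that the following holds for every $\varepsilon\in(0,1/2)$ and every function $f$ analytic on $\mathcal{N}_\gamma$ with $|f(z)|\le1$ for all $z\in\mathcal{N}_\gamma$: if one can compute approximations of each of $f^{(j)}(0)/j!$, for $j=0,1,\dots,C\log(1/\varepsilon)$, up to an additive error of $\varepsilon^C$ in time at most $T$, then one can compute an approximation of $f(1)$ up to an additive error of $\varepsilon$ in time $CT\log(1/\varepsilon)+\log^C(1/\varepsilon)$.
   Context: Computation is in a real/complex-valued model with unit cost for elementary arithmetic operations. *)

theory Defs
  imports "HOL-Complex_Analysis.Complex_Analysis"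
begin

definition nbhd :: "real \<Rightarrow> complex set" where
  "nbhd \<gamma> = {z. infdist z (complex_of_real ` {0..1}) < \<gamma>}"

text \<open>
  The model of computation is a random access machine with exact complex arithmetic at unit cost.
  A program sees a read-only input (the problem instance, a finite list of complex numbers) and a
  read-write memory consisting of arrays, where array \<open>a\<close> has the cells \<open>(a, 0), (a, 1), \<dots>\<close>.
  Array names are part of the program text, indices are computed at run time.
  As usual for algebraic machines, a program may contain arbitrary complex constants.
\<close>

datatype exp =
    Const complex
  | Arr nat exp
  | Inp exp
  | InpLen
  | Add exp exp
  | Sub exp exp
  | Mul exp exp
  | Div exp exp
  | RePart exp
  | ImPart exp

text \<open>The guards of \<open>Cond\<close> and \<open>While\<close> compare the real parts of two expressions.\<close>

datatype com =
    Skip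
  | Store nat exp exp
  | Seq com com
  | Cond exp exp com com
  | While exp exp com

type_synonym memory = "nat \<Rightarrow> nat \<Rightarrow> complex"

text \<open>
  Evaluation is partial: an array or input index that is not a natural number, an input index out
  of range, and a division by zero are errors. In particular, indexing does not provide
  a rounding operation.
\<close>

inductive eval :: "complex list \<Rightarrow> memory \<Rightarrow> exp \<Rightarrow> complex \<Rightarrow> bool"
  for x :: "complex list" and m :: memory where
  Const: "eval x m (Const c) c"
| Arr: "eval x m e (of_nat i) \<Longrightarrow> eval x m (Arr a e) (m a i)"
| Inp: "eval x m e (of_nat i) \<Longrightarrow> i < length x \<Longrightarrow> eval x m (Inp e) (x ! i)"
| InpLen: "eval x m InpLen (of_nat (length x))"
| Add: "eval x m e u \<Longrightarrow> eval x m e' v \<Longrightarrow> eval x m (Add e e') (u + v)"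
| Sub: "eval x m e u \<Longrightarrow> eval x m e' v \<Longrightarrow> eval x m (Sub e e') (u - v)"
| Mul: "eval x m e u \<Longrightarrow> eval x m e' v \<Longrightarrow> eval x m (Mul e e') (u * v)"
| Div: "eval x m e u \<Longrightarrow> eval x m e' v \<Longrightarrow> v \<noteq> 0 \<Longrightarrow> eval x m (Div e e') (u / v)"
| RePart: "eval x m e u \<Longrightarrow> eval x m (RePart e) (complex_of_real (Re u))"
| ImPart: "eval x m e u \<Longrightarrow> eval x m (ImPart e) (complex_of_real (Im u))"

text \<open>Each constant, memory or input access and arithmetic operation costs one unit of time.\<close>

primrec cost :: "exp \<Rightarrow> nat" where
  "cost (Const c) = 1"
| "cost (Arr a e) = cost e + 1"
| "cost (Inp e) = cost e + 1"
| "cost InpLen = 1"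
| "cost (Add e e') = cost e + cost e' + 1"
| "cost (Sub e e') = cost e + cost e' + 1"
| "cost (Mul e e') = cost e + cost e' + 1"
| "cost (Div e e') = cost e + cost e' + 1"
| "cost (RePart e) = cost e + 1"
| "cost (ImPart e) = cost e + 1"

text \<open>\<open>exec x p m t m'\<close>: on input \<open>x\<close>, program \<open>p\<close> started in memory \<open>m\<close> halts after exactly \<open>t\<close>
  units of time in memory \<open>m'\<close>.\<close>

inductive exec :: "complex list \<Rightarrow> com \<Rightarrow> memory \<Rightarrow> nat \<Rightarrow> memory \<Rightarrow> bool"
  for x :: "complex list" where
  Skip: "exec x Skip m 1 m"
| Store: "eval x m e (of_nat i) \<Longrightarrow> eval x m e' v \<Longrightarrow>
    exec x (Store a e e') m (cost e + cost e' + 1) (m(a := (m a)(i := v)))"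
| Seq: "exec x p m t m' \<Longrightarrow> exec x q m' t' m'' \<Longrightarrow> exec x (Seq p q) m (t + t') m''"
| CondTrue: "eval x m e u \<Longrightarrow> eval x m e' v \<Longrightarrow> Re u \<le> Re v \<Longrightarrow> exec x p m t m' \<Longrightarrow>
    exec x (Cond e e' p q) m (cost e + cost e' + 1 + t) m'"
| CondFalse: "eval x m e u \<Longrightarrow> eval x m e' v \<Longrightarrow> \<not> Re u \<le> Re v \<Longrightarrow> exec x q m t m' \<Longrightarrow>
    exec x (Cond e e' p q) m (cost e + cost e' + 1 + t) m'"
| WhileTrue: "eval x m e u \<Longrightarrow> eval x m e' v \<Longrightarrow> Re u \<le> Re v \<Longrightarrow> exec x p m t m' \<Longrightarrow>
    exec x (While e e' p) m' t' m'' \<Longrightarrow>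
    exec x (While e e' p) m (cost e + cost e' + 1 + t + t') m''"
| WhileFalse: "eval x m e u \<Longrightarrow> eval x m e' v \<Longrightarrow> \<not> Re u \<le> Re v \<Longrightarrow>
    exec x (While e e' p) m (cost e + cost e' + 1) m"

text \<open>The scalar arguments are passed in the first cells of array 0; all other cells are
  initially 0. The result is returned in cell \<open>(0, 0)\<close>.\<close>

definition init :: "complex list \<Rightarrow> memory" where
  "init args = (\<lambda>a i. if a = 0 \<and> i < length args then args ! i else 0)"

definition approximates_in_time ::
    "com \<Rightarrow> complex list \<Rightarrow> complex list \<Rightarrow> complex \<Rightarrow> real \<Rightarrow> real \<Rightarrow> bool" where
  "approximates_in_time p x args w \<delta> T \<longleftrightarrow>
     (\<exists>t m. exec x p (init args) t m \<and> cmod (m 0 0 - w) \<le> \<delta> \<and> real t \<le> T)"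

lemma eval_deterministic: "eval x m e u \<Longrightarrow> eval x m e v \<Longrightarrow> u = v"
proof (induction arbitrary: v rule: eval.induct)
  case (Arr e i a)
  from Arr.prems obtain k where "eval x m e (of_nat k)" "v = m a k" by (rule eval.cases) auto
  with Arr.IH show ?case by fastforce
next
  case (Inp e i)
  from Inp.prems obtain k where "eval x m e (of_nat k)" "v = x ! k" by (rule eval.cases) auto
  with Inp.IH show ?case by fastforce
next
  case (Add e u e' w)
  from Add.prems show ?case by (rule eval.cases) (use Add.IH in auto)
next
  case (Sub e u e' w)
  from Sub.prems show ?case by (rule eval.cases) (use Sub.IH in auto)
next
  case (Mul e u e' w)
  from Mul.prems show ?case by (rule eval.cases) (use Mul.IH in auto)
next
  case (Div e u e' w)
  from Div.prems show ?case by (rule eval.cases) (use Div.IH in auto)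
next
  case (RePart e u)
  from RePart.prems show ?case by (rule eval.cases) (use RePart.IH in auto)
next
  case (ImPart e u)
  from ImPart.prems show ?case by (rule eval.cases) (use ImPart.IH in auto)
qed (erule eval.cases; simp)+

lemma exec_deterministic:
  "exec x p m t m' \<Longrightarrow> exec x p m s n \<Longrightarrow> s = t \<and> n = m'"
proof (induction arbitrary: s n rule: exec.induct)
  case (Skip m)
  then show ?case by (rule exec.cases) auto
next
  case (Store m e i e' v a)
  from Store.prems obtain k w where
    "eval x m e (of_nat k)" "eval x m e' w" "s = cost e + cost e' + 1" "n = m(a := (m a)(k := w))"
    by (rule exec.cases) auto
  moreover from this Store.hyps have "k = i" "w = v"
    by (metis eval_deterministic of_nat_eq_iff)+
  ultimately show ?case by simp
next
  case (Seq p m t m' q t' m'')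
  from Seq.prems show ?case by (rule exec.cases) (use Seq.IH in auto)
next
  case (CondTrue m e u e' v p t m' q)
  have det: "a = u" "b = v" if "eval x m e a" "eval x m e' b" for a b
    using that CondTrue.hyps eval_deterministic by metis+
  from CondTrue.prems obtain r where "exec x p m r n" "s = cost e + cost e' + 1 + r"
    by (rule exec.cases) (use CondTrue.hyps(3) in \<open>simp_all, (metis det)+\<close>)
  with CondTrue.IH show ?case by blast
next
  case (CondFalse m e u e' v q t m' p)
  have det: "a = u" "b = v" if "eval x m e a" "eval x m e' b" for a b
    using that CondFalse.hyps eval_deterministic by metis+
  from CondFalse.prems obtain r where "exec x q m r n" "s = cost e + cost e' + 1 + r"
    by (rule exec.cases) (use CondFalse.hyps(3) in \<open>simp_all, (metis det)+\<close>)
  with CondFalse.IH show ?case by blast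
next
  case (WhileTrue m e u e' v p t m' t' m'')
  have det: "a = u" "b = v" if "eval x m e a" "eval x m e' b" for a b
    using that WhileTrue.hyps eval_deterministic by metis+
  from WhileTrue.prems obtain r k r' where "exec x p m r k" "exec x (While e e' p) k r' n"
    "s = cost e + cost e' + 1 + r + r'"
    by (rule exec.cases) (use WhileTrue.hyps(3) in \<open>simp_all, (metis det)+\<close>)
  with WhileTrue.IH show ?case by blast
next
  case (WhileFalse m e u e' v p)
  have det: "a = u" "b = v" if "eval x m e a" "eval x m e' b" for a b
    using that WhileFalse.hyps eval_deterministic by metis+
  from WhileFalse.prems show ?case
    by (rule exec.cases) (use WhileFalse.hyps(3) in \<open>simp_all, (metis det)+\<close>)
qed
end

theory Submission
  imports Defs
begin

text \<open>With \<open>\<rho> = \<gamma>/4\<close> and \<open>\<alpha> = 1 - exp (-1/\<rho>)\<close>, the map \<open>\<phi> z = - \<rho> Ln (1 - \<alpha> z)\<close> fixes 0 and 1 and sends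
  a disc of radius \<open>R > 1\<close> into the \<open>\<gamma>\<close>-neighbourhood of \<open>[0,1]\<close>. By Cauchy's estimate the Taylor
  coefficients of \<open>f \<circ> \<phi>\<close> decay like \<open>R\<^sup>-\<^sup>k\<close>, so their sum up to \<open>n = O(log (1/\<epsilon>))\<close>
  approximates \<open>f 1\<close>. Since \<open>1 - \<alpha> z = exp (- \<phi> z/\<rho>)\<close>, differentiation in \<open>z\<close> gives
  \<open>(f \<circ> \<phi>)\<^sup>(\<^sup>k\<^sup>) z / k! = h\<^sub>k (\<phi> z) / (1 - \<alpha> z)\<^sup>k\<close> with \<open>h\<^sub>0 = f\<close> and
  \<open>h\<^sub>k\<^sub>+\<^sub>1 = \<alpha> (\<rho> h\<^sub>k' + k h\<^sub>k) / (k + 1)\<close>. On Taylor coefficients at 0 this is a two-term recurrence,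
  which takes \<open>O(n\<^sup>2)\<close> operations and amplifies errors in the input by at most \<open>(1 + \<rho>)\<^sup>k\<close>.\<close>

section \<open>Running a program repeatedly on fresh memory\<close>

text \<open>Since \<open>exec\<close> is deterministic, a halting run is the only run, so this is a
  total-correctness statement with a time bound. The bound is real because \<open>T\<close>
  is.\<close>

definition halts_within ::
    "complex list \<Rightarrow> com \<Rightarrow> memory \<Rightarrow> real \<Rightarrow> (memory \<Rightarrow> bool) \<Rightarrow> bool" where
  "halts_within x p m \<tau> Q \<longleftrightarrow> (\<exists>t m'. exec x p m t m' \<and> real t \<le> \<tau> \<and> Q m')"

lemma halts_within_Store:
  assumes "eval x m e (of_nat i)" "eval x m e' v" "Q (m(a := (m a)(i := v)))"
  shows "halts_within x (Store a e e') m (real (cost e + cost e' + 1)) Q"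
  using exec.Store[OF assms(1,2)] assms(3) unfolding halts_within_def by blast

lemma halts_within_Seq:
  assumes "halts_within x p m \<sigma> Q" "\<And>m'. Q m' \<Longrightarrow> halts_within x q m' \<tau> S"
  shows "halts_within x (Seq p q) m (\<sigma> + \<tau>) S"
proof -
  obtain t m' where 1: "exec x p m t m'" "real t \<le> \<sigma>" "Q m'"
    using assms(1) unfolding halts_within_def by blast
  obtain t' m'' where 2: "exec x q m' t' m''" "real t' \<le> \<tau>" "S m''"
    using assms(2)[OF 1(3)] unfolding halts_within_def by blast
  have "exec x (Seq p q) m (t + t') m''"
    by (rule exec.Seq[OF 1(1) 2(1)])
  then show ?thesis
    using 1 2 unfolding halts_within_def by (intro exI[of _ "t + t'"] exI[of _ m'']) auto
qed

lemma halts_within_mono: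
  assumes "halts_within x p m \<sigma> Q" "\<sigma> \<le> \<tau>" "\<And>m'. Q m' \<Longrightarrow> S m'"
  shows "halts_within x p m \<tau> S"
  using assms unfolding halts_within_def by (meson order_trans)

text \<open>The invariant carries the round number and the number \<open>n\<close> of rounds is
  exact, so induction on the rounds still to go adds up the time: \<open>n\<close> bodies and
  \<open>n + 1\<close> guards.\<close>

lemma halts_within_While:
  assumes true: "\<And>i m. i < n \<Longrightarrow> I i m \<Longrightarrow>
      \<exists>u v. eval x m e u \<and> eval x m e' v \<and> Re u \<le> Re v"
    and body: "\<And>i m. i < n \<Longrightarrow> I i m \<Longrightarrow> halts_within x p m \<tau> (I (Suc i))"
    and false: "\<And>m. I n m \<Longrightarrow> \<exists>u v. eval x m e u \<and> eval x m e' v \<and> \<not> Re u \<le> Re v"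
    and init: "I 0 m"
  shows "halts_within x (While e e' p) m
    (real n * (real (cost e + cost e' + 1) + \<tau>) + real (cost e + cost e' + 1)) (I n)"
proof -
  let ?g = "real (cost e + cost e' + 1)"
  have "halts_within x (While e e' p) m (real d * (?g + \<tau>) + ?g) (I n)"
    if "i + d = n" "I i m" for i d m
    using that
  proof (induction d arbitrary: i m)
    case 0
    then have "I n m" by simp
    then obtain u v where "eval x m e u" "eval x m e' v" "\<not> Re u \<le> Re v"
      using false by blast
    from exec.WhileFalse[OF this, of p] show ?case
      using 0 unfolding halts_within_def by fastforce
  next
    case (Suc d)
    have i: "i < n" using Suc.prems(1) by simp
    obtain u v where uv: "eval x m e u" "eval x m e' v" "Re u \<le> Re v"
      using true[OF i Suc.prems(2)] by blast
    obtain t m' where 1: "exec x p m t m'" "real t \<le> \<tau>" "I (Suc i) m'"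
      using body[OF i Suc.prems(2)] unfolding halts_within_def by blast
    have "Suc i + d = n" using Suc.prems(1) by simp
    then obtain t' m'' where 2: "exec x (While e e' p) m' t' m''"
        "real t' \<le> real d * (?g + \<tau>) + ?g" "I n m''"
      using Suc.IH[of "Suc i" m'] 1(3) unfolding halts_within_def by blast
    from exec.WhileTrue[OF uv 1(1) 2(1)] show ?case
      unfolding halts_within_def
      by (intro exI conjI, assumption)
        (use 1 2 in \<open>auto simp: algebra_simps\<close>)
  qed
  from this[of 0 n m] init show ?thesis by simp
qed

text \<open>Array 0 holds the variables of the program: cell 0 the input \<epsilon> and finally the
  result, cell 1 the number of terms, cells 2 and 4 loop counters, cell 3 a running power and later
  the running sum.\<close>

abbreviation scalar :: "nat \<Rightarrow> exp" where
  "scalar n \<equiv> Arr 0 (Const (of_nat n))"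

abbreviation assign :: "nat \<Rightarrow> exp \<Rightarrow> com" where
  "assign n \<equiv> Store 0 (Const (of_nat n))"

lemma eval_scalar: "eval x m (scalar n) (m 0 n)"
  by (intro eval.intros)

lemma eval_ConstI: "c = u \<Longrightarrow> eval x m (Const c) u"
  by (simp add: eval.Const)

section \<open>Simulating a run inside one residue class of the indices\<close>

text \<open>In round \<open>j\<close> of \<open>N\<close>, cell \<open>(a, i)\<close> of the simulated program is kept in cell
  \<open>(Suc a, i * N + j)\<close>. So every round finds its cells untouched by the other rounds, although
  a program may address cells whose indices are not bounded in terms of its running time. Cells 1
  and 2 of array 0 hold \<open>N\<close> and \<open>j\<close>.\<close>

abbreviation spread :: "exp \<Rightarrow> exp" where
  "spread e \<equiv> Add (Mul e (scalar 1)) (scalar 2)"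

primrec spread_exp :: "exp \<Rightarrow> exp" where
  "spread_exp (Const c) = Const c"
| "spread_exp (Arr a e) = Arr (Suc a) (spread (spread_exp e))"
| "spread_exp (Inp e) = Inp (spread_exp e)"
| "spread_exp InpLen = InpLen"
| "spread_exp (Add e e') = Add (spread_exp e) (spread_exp e')"
| "spread_exp (Sub e e') = Sub (spread_exp e) (spread_exp e')"
| "spread_exp (Mul e e') = Mul (spread_exp e) (spread_exp e')"
| "spread_exp (Div e e') = Div (spread_exp e) (spread_exp e')"
| "spread_exp (RePart e) = RePart (spread_exp e)"
| "spread_exp (ImPart e) = ImPart (spread_exp e)"

primrec spread_com :: "com \<Rightarrow> com" where
  "spread_com Skip = Skip"
| "spread_com (Store a e e') = Store (Suc a) (spread (spread_exp e)) (spread_exp e')"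
| "spread_com (Seq p q) = Seq (spread_com p) (spread_com q)"
| "spread_com (Cond e e' p q) =
    Cond (spread_exp e) (spread_exp e') (spread_com p) (spread_com q)"
| "spread_com (While e e' p) = While (spread_exp e) (spread_exp e') (spread_com p)"

definition holds_round :: "nat \<Rightarrow> nat \<Rightarrow> memory \<Rightarrow> memory \<Rightarrow> bool" where
  "holds_round N j m M \<longleftrightarrow> j < N \<and> M 0 1 = of_nat N \<and> M 0 2 = of_nat j \<and>
     (\<forall>a i. M (Suc a) (i * N + j) = m a i)"

text \<open>Only array accesses become dearer, by six units each for the new index, and every access
  already pays one unit of its own.\<close>

lemma cost_spread_exp: "cost (spread_exp e) \<le> 7 * cost e"
  by (induction e) auto

lemma eval_spread:
  assumes "holds_round N j m M" "eval x M e (of_nat i)"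
  shows "eval x M (spread e) (of_nat (i * N + j))"
proof -
  have "eval x M (spread e) (of_nat i * M 0 1 + M 0 2)"
    using assms(2) by (intro eval.Add eval.Mul eval_scalar)
  then show ?thesis using assms(1) by (simp add: holds_round_def)
qed

lemma eval_spread_exp:
  assumes "eval x m e u" "holds_round N j m M"
  shows "eval x M (spread_exp e) u"
  using assms
proof (induction rule: eval.induct)
  case (Arr e i a)
  have "eval x M (Arr (Suc a) (spread (spread_exp e))) (M (Suc a) (i * N + j))"
    by (intro eval.Arr eval_spread[OF Arr.prems] Arr.IH[OF Arr.prems])
  then show ?case using Arr.prems by (simp add: holds_round_def)
qed (auto intro: eval.intros)

text \<open>A run is copied step by step. The last conjunct is a frame condition: the loop data in
  array 0 and the cells of all other residues mod \<open>N\<close> survive, so earlier results are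
  kept and later rounds find fresh memory.\<close>

lemma exec_spread_com:
  assumes "exec x p m t m'" "holds_round N j m M"
  shows "\<exists>t' M'. exec x (spread_com p) M t' M' \<and> t' \<le> 7 * t \<and> holds_round N j m' M' \<and>
    (\<forall>a i. a = 0 \<or> i mod N \<noteq> j \<longrightarrow> M' a i = M a i)"
  using assms
proof (induction arbitrary: M rule: exec.induct)
  case (Skip m)
  then show ?case using exec.Skip by fastforce
next
  case (Store m e i e' v a)
  have "exec x (spread_com (Store a e e')) M
      (cost (spread (spread_exp e)) + cost (spread_exp e') + 1)
      (M(Suc a := (M (Suc a))(i * N + j := v)))"
    unfolding spread_com.simps
    by (intro exec.Store eval_spread[OF Store.prems] eval_spread_exp[OF _ Store.prems] Store.hyps)
  moreover have "cost (spread (spread_exp e)) + cost (spread_exp e') + 1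
      \<le> 7 * (cost e + cost e' + 1)"
    using cost_spread_exp[of e] cost_spread_exp[of e'] by simp
  moreover have "holds_round N j (m(a := (m a)(i := v))) (M(Suc a := (M (Suc a))(i * N + j := v)))"
    using Store.prems by (auto simp: holds_round_def)
  moreover have "\<forall>b k. b = 0 \<or> k mod N \<noteq> j \<longrightarrow>
      (M(Suc a := (M (Suc a))(i * N + j := v))) b k = M b k"
    using Store.prems by (auto simp: holds_round_def)
  ultimately show ?case by blast
next
  case (Seq p m t m' q t' m'')
  obtain s M' where 1: "exec x (spread_com p) M s M'" "s \<le> 7 * t" "holds_round N j m' M'"
      "\<forall>a i. a = 0 \<or> i mod N \<noteq> j \<longrightarrow> M' a i = M a i"
    using Seq.IH(1)[OF Seq.prems] by blast
  obtain s' M'' where 2: "exec x (spread_com q) M' s' M''" "s' \<le> 7 * t'" "holds_round N j m'' M''"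
      "\<forall>a i. a = 0 \<or> i mod N \<noteq> j \<longrightarrow> M'' a i = M' a i"
    using Seq.IH(2)[OF 1(3)] by blast
  have "exec x (spread_com (Seq p q)) M (s + s') M''"
    using exec.Seq[OF 1(1) 2(1)] by simp
  then show ?case using 1 2
    by (intro exI[of _ "s + s'"] exI[of _ M'']) auto
next
  case (CondTrue m e u e' v p t m' q)
  obtain s M' where 1: "exec x (spread_com p) M s M'" "s \<le> 7 * t" "holds_round N j m' M'"
      "\<forall>a i. a = 0 \<or> i mod N \<noteq> j \<longrightarrow> M' a i = M a i"
    using CondTrue.IH[OF CondTrue.prems] by blast
  have "exec x (spread_com (Cond e e' p q)) M
      (cost (spread_exp e) + cost (spread_exp e') + 1 + s) M'"
    using CondTrue.hyps CondTrue.prems 1(1)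
    by (auto intro!: exec.CondTrue[of _ _ _ u _ v] eval_spread_exp simp del: One_nat_def)
  then show ?case using 1 cost_spread_exp[of e] cost_spread_exp[of e']
    by (intro exI[of _ "cost (spread_exp e) + cost (spread_exp e') + 1 + s"] exI[of _ M']) auto
next
  case (CondFalse m e u e' v q t m' p)
  obtain s M' where 1: "exec x (spread_com q) M s M'" "s \<le> 7 * t" "holds_round N j m' M'"
      "\<forall>a i. a = 0 \<or> i mod N \<noteq> j \<longrightarrow> M' a i = M a i"
    using CondFalse.IH[OF CondFalse.prems] by blast
  have "exec x (spread_com (Cond e e' p q)) M
      (cost (spread_exp e) + cost (spread_exp e') + 1 + s) M'"
    using CondFalse.hyps CondFalse.prems 1(1)
    by (auto intro!: exec.CondFalse[of _ _ _ u _ v] eval_spread_exp simp del: One_nat_def)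
  then show ?case using 1 cost_spread_exp[of e] cost_spread_exp[of e']
    by (intro exI[of _ "cost (spread_exp e) + cost (spread_exp e') + 1 + s"] exI[of _ M']) auto
next
  case (WhileTrue m e u e' v p t m' t' m'')
  obtain s M' where 1: "exec x (spread_com p) M s M'" "s \<le> 7 * t" "holds_round N j m' M'"
      "\<forall>a i. a = 0 \<or> i mod N \<noteq> j \<longrightarrow> M' a i = M a i"
    using WhileTrue.IH(1)[OF WhileTrue.prems] by blast
  obtain s' M'' where 2: "exec x (spread_com (While e e' p)) M' s' M''" "s' \<le> 7 * t'"
      "holds_round N j m'' M''" "\<forall>a i. a = 0 \<or> i mod N \<noteq> j \<longrightarrow> M'' a i = M' a i"
    using WhileTrue.IH(2)[OF 1(3)] by blast
  have "exec x (spread_com (While e e' p)) M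
      (cost (spread_exp e) + cost (spread_exp e') + 1 + s + s') M''"
    using WhileTrue.hyps WhileTrue.prems 1(1) 2(1)
    by (auto intro!: exec.WhileTrue[of _ _ _ u _ v] eval_spread_exp simp del: One_nat_def)
  then show ?case using 1 2 cost_spread_exp[of e] cost_spread_exp[of e']
    by (intro exI[of _ "cost (spread_exp e) + cost (spread_exp e') + 1 + s + s'"] exI[of _ M''])
      auto
next
  case (WhileFalse m e u e' v p)
  have "exec x (spread_com (While e e' p)) M
      (cost (spread_exp e) + cost (spread_exp e') + 1) M"
    using WhileFalse.hyps WhileFalse.prems
    by (auto intro!: exec.WhileFalse[of _ _ _ u _ v] eval_spread_exp simp del: One_nat_def)
  then show ?case using WhileFalse.prems cost_spread_exp[of e] cost_spread_exp[of e']
    by (intro exI[of _ "cost (spread_exp e) + cost (spread_exp e') + 1"] exI[of _ M]) auto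
qed

section \<open>Taylor coefficients after the conformal change of variable\<close>

text \<open>If \<open>a\<close> lists the Taylor coefficients of \<open>f\<close> at 0, entry
  \<open>(k, j)\<close> is the \<open>j\<close>-th Taylor coefficient of \<open>h\<^sub>k\<close>,
  and column 0 belongs to the composition of \<open>f\<close> with \<phi>. The sequence is arbitrary
  so that the recurrence can also run on approximate coefficients.\<close>

primrec transformed_coeff :: "real \<Rightarrow> real \<Rightarrow> (nat \<Rightarrow> complex) \<Rightarrow> nat \<Rightarrow> nat \<Rightarrow> complex" where
  "transformed_coeff \<alpha> \<rho> a 0 j = a j"
| "transformed_coeff \<alpha> \<rho> a (Suc k) j = of_real \<alpha> *
     (of_real \<rho> * of_nat (Suc j) * transformed_coeff \<alpha> \<rho> a k (Suc j)
        + of_nat k * transformed_coeff \<alpha> \<rho> a k j) / of_nat (Suc k)"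

text \<open>The recurrence is linear, and the binomial absorbs its factors:
  \<open>(j+1) * ((k+j+1) choose (j+1))\<close> equals \<open>(k+1) * ((k+1+j) choose j)\<close>,
  and \<open>k * ((k+j) choose j)\<close> is at most that. After division by \<open>k+1\<close> each
  row costs a factor \<open>\<rho> + 1\<close>; in column 0 the binomial is 1.\<close>

lemma transformed_coeff_perturb:
  assumes "0 \<le> \<alpha>" "\<alpha> \<le> 1" "0 \<le> \<rho>" "0 \<le> \<delta>"
    and "\<And>i. i \<le> k + j \<Longrightarrow> cmod (a i - b i) \<le> \<delta>"
  shows "cmod (transformed_coeff \<alpha> \<rho> a k j - transformed_coeff \<alpha> \<rho> b k j)
    \<le> \<delta> * (1 + \<rho>) ^ k * real ((k + j) choose j)"
  using assms(5)
proof (induction k arbitrary: j)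
  case 0
  then show ?case by simp
next
  case (Suc k)
  define d where "d j = transformed_coeff \<alpha> \<rho> a k j - transformed_coeff \<alpha> \<rho> b k j" for j
  define E where "E = \<delta> * (1 + \<rho>) ^ k"
  have E: "0 \<le> E" using assms by (simp add: E_def)
  have d1: "cmod (d (Suc j)) \<le> E * real ((k + Suc j) choose Suc j)"
    using Suc.IH[of "Suc j"] Suc.prems unfolding d_def E_def by simp
  have d0: "cmod (d j) \<le> E * real ((k + j) choose j)"
    using Suc.IH[of j] Suc.prems unfolding d_def E_def by simp
  have "Suc j * ((k + Suc j) choose Suc j) = Suc (k + j) * ((k + j) choose j)"
    using Suc_times_binomial_eq[of "k + j" j] by (simp add: mult.commute)
  moreover have "Suc k * ((Suc k + j) choose Suc k) = Suc (k + j) * ((k + j) choose k)"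
    using Suc_times_binomial_eq[of "k + j" k] by (simp add: mult.commute)
  moreover have "(Suc k + j) choose Suc k = (Suc k + j) choose j"
    "(k + j) choose k = (k + j) choose j"
    using binomial_symmetric[of "Suc k" "Suc k + j"] binomial_symmetric[of k "k + j"] by simp_all
  ultimately have b1: "real (Suc j) * real ((k + Suc j) choose Suc j)
      = real (Suc k) * real ((Suc k + j) choose j)"
    by (metis of_nat_mult)
  have b0: "real k * real ((k + j) choose j) \<le> real (Suc k) * real ((Suc k + j) choose j)"
    by (intro mult_mono) (auto intro!: binomial_right_mono)
  have "transformed_coeff \<alpha> \<rho> a (Suc k) j - transformed_coeff \<alpha> \<rho> b (Suc k) j
      = of_real \<alpha> * (of_real \<rho> * of_nat (Suc j) * d (Suc j) + of_nat k * d j) / of_nat (Suc k)"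
    by (simp add: d_def diff_divide_distrib[symmetric] algebra_simps del: of_nat_Suc)
  then have "cmod (transformed_coeff \<alpha> \<rho> a (Suc k) j - transformed_coeff \<alpha> \<rho> b (Suc k) j)
      = \<alpha> * cmod (of_real \<rho> * of_nat (Suc j) * d (Suc j) + of_nat k * d j) / real (Suc k)"
    using assms by (simp add: norm_mult norm_divide del: of_nat_Suc)
  also have "\<dots> \<le> 1 * (\<rho> * real (Suc j) * (E * real ((k + Suc j) choose Suc j))
      + real k * (E * real ((k + j) choose j))) / real (Suc k)"
  proof (intro divide_right_mono mult_mono)
    show "cmod (of_real \<rho> * of_nat (Suc j) * d (Suc j) + of_nat k * d j)
      \<le> \<rho> * real (Suc j) * (E * real ((k + Suc j) choose Suc j)) + real k * (E * real ((k + j) choose j))"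
      using assms d0 d1
      by (intro order_trans[OF norm_triangle_ineq] add_mono)
        (auto simp: norm_mult simp del: of_nat_Suc intro!: mult_mono)
  qed (use assms in auto)
  also have "\<rho> * real (Suc j) * (E * real ((k + Suc j) choose Suc j))
      = \<rho> * E * (real (Suc k) * real ((Suc k + j) choose j))"
    unfolding b1[symmetric] by (simp only: mult_ac)
  also have "1 * (\<rho> * E * (real (Suc k) * real ((Suc k + j) choose j))
      + real k * (E * real ((k + j) choose j))) / real (Suc k)
    \<le> (\<rho> * E * (real (Suc k) * real ((Suc k + j) choose j))
      + E * (real (Suc k) * real ((Suc k + j) choose j))) / real (Suc k)"
    using mult_left_mono[OF b0 E] unfolding mult_1
    by (intro divide_right_mono add_left_mono) (simp_all only: mult_ac of_nat_0_le_iff)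
  also have "\<dots> = \<delta> * (1 + \<rho>) ^ Suc k * real ((Suc k + j) choose j)"
    by (simp add: E_def field_simps del: of_nat_Suc)
  finally show ?case .
qed

section \<open>Derivatives of f composed with the logarithmic map\<close>

primrec pullback :: "real \<Rightarrow> real \<Rightarrow> (complex \<Rightarrow> complex) \<Rightarrow> nat \<Rightarrow> complex \<Rightarrow> complex" where
  "pullback \<alpha> \<rho> f 0 = f"
| "pullback \<alpha> \<rho> f (Suc k) = (\<lambda>w. of_real (\<alpha> * \<rho> / real (Suc k)) * deriv (pullback \<alpha> \<rho> f k) w
     + of_real (\<alpha> * real k / real (Suc k)) * pullback \<alpha> \<rho> f k w)"

lemma pullback_holomorphic:
  "f holomorphic_on U \<Longrightarrow> open U \<Longrightarrow> pullback \<alpha> \<rho> f k holomorphic_on U"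
  by (induction k) (auto intro!: holomorphic_intros)

text \<open>Differentiating the definition of \<open>pullback\<close> \<open>j\<close> times gives
  the recurrence; the factor \<open>Suc j\<close> arises because the \<open>j\<close>-th Taylor
  coefficient of a derivative is \<open>j + 1\<close> times the next coefficient of the
  function.\<close>

lemma higher_deriv_pullback:
  assumes "f holomorphic_on U" "open U" "w \<in> U"
  shows "(deriv ^^ j) (pullback \<alpha> \<rho> f k) w / fact j
    = transformed_coeff \<alpha> \<rho> (\<lambda>j. (deriv ^^ j) f w / fact j) k j"
proof (induction k arbitrary: j)
  case 0
  then show ?case by simp
next
  case (Suc k)
  let ?h = "pullback \<alpha> \<rho> f k"
  have h: "?h holomorphic_on U" using assms by (intro pullback_holomorphic)
  have "(deriv ^^ j) (pullback \<alpha> \<rho> f (Suc k)) w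
      = (deriv ^^ j) (\<lambda>w. of_real (\<alpha> * \<rho> / real (Suc k)) * deriv ?h w) w
      + (deriv ^^ j) (\<lambda>w. of_real (\<alpha> * real k / real (Suc k)) * ?h w) w"
    unfolding pullback.simps using h assms by (intro higher_deriv_add[of _ U] holomorphic_intros)
  also have "(deriv ^^ j) (\<lambda>w. of_real (\<alpha> * \<rho> / real (Suc k)) * deriv ?h w) w
      = of_real (\<alpha> * \<rho> / real (Suc k)) * (deriv ^^ j) (deriv ?h) w"
    using h assms by (intro higher_deriv_cmult[of _ U] holomorphic_intros)
  also have "(deriv ^^ j) (deriv ?h) = (deriv ^^ Suc j) ?h"
    by (simp add: funpow_swap1)
  also have "(deriv ^^ j) (\<lambda>w. of_real (\<alpha> * real k / real (Suc k)) * ?h w) w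
      = of_real (\<alpha> * real k / real (Suc k)) * (deriv ^^ j) ?h w"
    using h assms by (intro higher_deriv_cmult[of _ U] holomorphic_intros)
  finally have eq: "(deriv ^^ j) (pullback \<alpha> \<rho> f (Suc k)) w
      = of_real (\<alpha> * \<rho> / real (Suc k)) * (deriv ^^ Suc j) ?h w
      + of_real (\<alpha> * real k / real (Suc k)) * (deriv ^^ j) ?h w" .
  have s: "(deriv ^^ i) ?h w = fact i * transformed_coeff \<alpha> \<rho> (\<lambda>j. (deriv ^^ j) f w / fact j) k i" for i
    using Suc.IH[of i] by (simp add: field_simps)
  show ?case unfolding eq s
    by (simp add: field_simps del: of_nat_Suc)
qed

text \<open>With \<open>q = 1 - \<alpha> z\<close>, both the derivative
  \<open>\<rho> \<alpha> / q\<close> of \<phi> and the derivative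
  \<open>k \<alpha> / q^(k+1)\<close> of \<open>1 / q^k\<close> bring one more factor
  \<open>1 / q\<close>, so the quotient keeps its form.\<close>

lemma higher_deriv_compose_log:
  fixes f :: "complex \<Rightarrow> complex" and \<alpha> \<rho> :: real
  defines "\<phi> \<equiv> \<lambda>z. - of_real \<rho> * Ln (1 - of_real \<alpha> * z)"
  assumes f: "f holomorphic_on U" "open U" and V: "open V" "\<And>z. z \<in> V \<Longrightarrow> \<phi> z \<in> U"
    "\<And>z. z \<in> V \<Longrightarrow> 0 < Re (1 - of_real \<alpha> * z)"
    and "z \<in> V"
  shows "(deriv ^^ k) (\<lambda>z. f (\<phi> z)) z / fact k
    = pullback \<alpha> \<rho> f k (\<phi> z) / (1 - of_real \<alpha> * z) ^ k"
  using assms(7)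
proof (induction k arbitrary: z)
  case 0
  then show ?case by simp
next
  case (Suc k)
  let ?h = "pullback \<alpha> \<rho> f k" and ?q = "1 - of_real \<alpha> * z"
  have q: "?q \<notin> \<real>\<^sub>\<le>\<^sub>0"
    using V(3)[OF Suc.prems] by (auto simp: complex_nonpos_Reals_iff)
  then have "?q \<noteq> 0" by (metis nonpos_Reals_zero_I)
  note q = this q
  have h: "?h holomorphic_on U" using f by (intro pullback_holomorphic)
  have phi: "(\<phi> has_field_derivative of_real \<rho> * of_real \<alpha> / ?q) (at z)"
    unfolding \<phi>_def using q by (auto intro!: derivative_eq_intros simp: field_simps)
  have hd: "(?h has_field_derivative deriv ?h (\<phi> z)) (at (\<phi> z))"
    using h f V(2)[OF Suc.prems] by (auto intro: holomorphic_derivI)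
  have c: "((\<lambda>z. ?h (\<phi> z)) has_field_derivative deriv ?h (\<phi> z) * (of_real \<rho> * of_real \<alpha> / ?q)) (at z)"
    by (rule DERIV_chain2[OF hd phi])
  have "((\<lambda>z. ?h (\<phi> z) / (1 - of_real \<alpha> * z) ^ k) has_field_derivative
      pullback \<alpha> \<rho> f (Suc k) (\<phi> z) / ?q ^ Suc k * of_nat (Suc k)) (at z)"
  proof (rule DERIV_cong)
    show "((\<lambda>z. ?h (\<phi> z) / (1 - of_real \<alpha> * z) ^ k) has_field_derivative
      (deriv ?h (\<phi> z) * (of_real \<rho> * of_real \<alpha> / ?q) * ?q ^ k
        - ?h (\<phi> z) * (of_nat k * (?q ^ (k - 1) * (- of_real \<alpha>)))) / (?q ^ k * ?q ^ k)) (at z)"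
      using q by (intro DERIV_divide c) (auto intro!: derivative_eq_intros)
    have "(d * (of_real \<rho> * of_real \<alpha> / q) * q ^ k
        - h * (of_nat k * (q ^ (k - 1) * (- of_real \<alpha>)))) / (q ^ k * q ^ k)
      = (of_real (\<alpha> * \<rho> / real (Suc k)) * d + of_real (\<alpha> * real k / real (Suc k)) * h)
        / q ^ Suc k * of_nat (Suc k)" if "q \<noteq> 0" for d h q :: complex
    proof -
      \<comment> \<open>For \<open>k = 0\<close> the exponent \<open>k - 1\<close> is truncated to
        0, but the factor \<open>of_nat k\<close> makes both sides vanish.\<close>
      have "of_nat k * (q ^ (k - 1)) = of_nat k * q ^ k / q"
        using that by (cases k) simp_all
      then have "(d * (of_real \<rho> * of_real \<alpha> / q) * q ^ k
        - h * (of_nat k * (q ^ (k - 1) * (- of_real \<alpha>)))) / (q ^ k * q ^ k)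
        = (of_real \<alpha> * of_real \<rho> * d + of_real \<alpha> * of_nat k * h) / q ^ Suc k"
        using that by (cases "k = 0") (auto simp: field_simps)
      also have "\<dots> = (of_real (\<alpha> * \<rho> / real (Suc k)) * d
          + of_real (\<alpha> * real k / real (Suc k)) * h) / q ^ Suc k * of_nat (Suc k)"
        by (simp add: divide_simps algebra_simps del: of_nat_Suc power_Suc)
      finally show ?thesis .
    qed
    from this[OF q(1)] show "(deriv ?h (\<phi> z) * (of_real \<rho> * of_real \<alpha> / ?q) * ?q ^ k
        - ?h (\<phi> z) * (of_nat k * (?q ^ (k - 1) * (- of_real \<alpha>)))) / (?q ^ k * ?q ^ k)
      = pullback \<alpha> \<rho> f (Suc k) (\<phi> z) / ?q ^ Suc k * of_nat (Suc k)"
      by (simp only: pullback.simps)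
  qed
  \<comment> \<open>The induction hypothesis holds on all of the open set \<open>V\<close>, so near
    \<open>z\<close> the quotient may be replaced by the scaled \<open>k\<close>-th
    derivative.\<close>
  then have "((\<lambda>z. (deriv ^^ k) (\<lambda>z. f (\<phi> z)) z / fact k) has_field_derivative
      pullback \<alpha> \<rho> f (Suc k) (\<phi> z) / ?q ^ Suc k * of_nat (Suc k)) (at z)"
    by (rule has_field_derivative_transform_within_open[OF _ V(1) Suc.prems])
      (simp add: Suc.IH)
  from DERIV_cmult[OF this, of "fact k"]
  have "((deriv ^^ k) (\<lambda>z. f (\<phi> z)) has_field_derivative
      fact k * (pullback \<alpha> \<rho> f (Suc k) (\<phi> z) / ?q ^ Suc k * of_nat (Suc k))) (at z)"
    by simp
  from DERIV_imp_deriv[OF this] show ?case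
    by (simp add: field_simps del: of_nat_Suc pullback.simps power_Suc)
qed

section \<open>The image of the disc of radius R and the truncation error\<close>

lemma open_nbhd: "open (nbhd \<gamma>)"
  unfolding nbhd_def by (intro open_Collect_less continuous_intros)

text \<open>The modulus of \<open>1 - \<alpha> z\<close> lies between
  \<open>exp (- 1/\<rho> - 1)\<close> and \<open>exp 1\<close>, so the image has real part in
  \<open>[- \<rho>, 1 + \<rho>]\<close>. The positive real part of \<open>1 - \<alpha> z\<close>
  keeps its argument below 2 in absolute value, so the imaginary part is at most
  \<open>2 \<rho>\<close>. The distance to \<open>[0,1]\<close> is then at most
  \<open>3 \<rho>\<close>, which is below \<gamma>.\<close>

lemma log_map_in_nbhd:
  fixes z :: complex and \<alpha> \<rho> \<gamma> R :: real
  assumes "0 < \<rho>" "\<rho> = \<gamma> / 4" "0 < \<alpha>" "\<alpha> * R = 1 - exp (- 1 / \<rho> - 1)" "cmod z \<le> R"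
  shows "- of_real \<rho> * Ln (1 - of_real \<alpha> * z) \<in> nbhd \<gamma>" "0 < Re (1 - of_real \<alpha> * z)"
proof -
  let ?q = "1 - of_real \<alpha> * z" and ?w = "- of_real \<rho> * Ln (1 - of_real \<alpha> * z)"
  have az: "cmod (of_real \<alpha> * z) \<le> 1 - exp (- 1 / \<rho> - 1)"
    using assms mult_left_mono[OF assms(5), of \<alpha>] by (simp add: norm_mult)
  have "Re (of_real \<alpha> * z) \<le> cmod (of_real \<alpha> * z)" by (rule complex_Re_le_cmod)
  also have "\<dots> < 1" using az by (smt (verit) exp_gt_zero)
  finally show pos: "0 < Re ?q" by simp
  then have q0: "?q \<noteq> 0" by (metis less_irrefl zero_complex.sel(1))
  have "exp (- 1 / \<rho> - 1) \<le> cmod ?q"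
    using norm_triangle_ineq2[of 1 "of_real \<alpha> * z"] az by simp
  then have lo: "- 1 / \<rho> - 1 \<le> ln (cmod ?q)"
    using q0 by (simp add: ln_ge_iff)
  have "cmod ?q \<le> 2"
    using norm_triangle_ineq4[of 1 "of_real \<alpha> * z"] az by (smt (verit) exp_gt_zero norm_one)
  also have "\<dots> \<le> exp 1" using exp_ge_add_one_self[of "1::real"] by simp
  finally have hi: "ln (cmod ?q) \<le> 1"
    using q0 by (metis exp_le_cancel_iff exp_ln zero_less_norm_iff)
  have re: "- \<rho> \<le> Re ?w" "Re ?w \<le> 1 + \<rho>"
    using lo hi assms(1) q0 mult_left_mono[OF lo, of \<rho>] mult_left_mono[OF hi, of \<rho>]
    by (auto simp: field_simps)
  have "\<bar>Im (Ln ?q)\<bar> < 2"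
    using Re_Ln_pos_lt[OF q0] pos pi_less_4 by simp
  then have im: "\<bar>Im ?w\<bar> \<le> \<rho> * 2"
    using assms(1) by (simp add: abs_mult)
  define r where "r = max 0 (min 1 (Re ?w))"
  have "infdist ?w (complex_of_real ` {0..1}) \<le> dist ?w (of_real r)"
    by (rule infdist_le) (auto simp: r_def)
  also have "\<dots> \<le> \<bar>Re (?w - of_real r)\<bar> + \<bar>Im (?w - of_real r)\<bar>"
    unfolding dist_norm by (rule cmod_le)
  also have "\<dots> \<le> \<rho> + \<rho> * 2"
    using re im assms(1) by (intro add_mono) (auto simp: r_def max_def min_def)
  also have "\<dots> < \<gamma>" using assms by simp
  finally show "?w \<in> nbhd \<gamma>" by (simp add: nbhd_def)
qed

lemma truncated_transform_error:
  fixes f :: "complex \<Rightarrow> complex" and \<alpha> \<rho> \<gamma> R :: real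
  assumes "0 < \<gamma>" "\<rho> = \<gamma> / 4" "\<alpha> = 1 - exp (- 1 / \<rho>)" "R = (1 - exp (- 1 / \<rho> - 1)) / \<alpha>"
    and f: "f analytic_on nbhd \<gamma>" "\<And>z. z \<in> nbhd \<gamma> \<Longrightarrow> cmod (f z) \<le> 1"
  shows "cmod (f 1 - (\<Sum>k<N. transformed_coeff \<alpha> \<rho> (\<lambda>j. (deriv ^^ j) f 0 / fact j) k 0))
    \<le> (1 / R) ^ N / (1 - 1 / R)"
proof -
  define \<phi> where "\<phi> = (\<lambda>z. - of_real \<rho> * Ln (1 - of_real \<alpha> * z))"
  define g where "g = (\<lambda>z. f (\<phi> z))"
  define c where "c = (\<lambda>k. transformed_coeff \<alpha> \<rho> (\<lambda>j. (deriv ^^ j) f 0 / fact j) k 0)"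
  have \<rho>: "0 < \<rho>" using assms by simp
  have \<alpha>: "0 < \<alpha>" using assms(3) \<rho> by simp
  \<comment> \<open>At \<open>z = 1\<close> the value of \<open>1 - \<alpha> z\<close> is
    \<open>exp (- 1/\<rho>)\<close>; letting it shrink by one more factor \<open>exp 1\<close>
    yields a radius beyond 1.\<close>
  have "\<alpha> < 1 - exp (- 1 / \<rho> - 1)" using assms(3) by simp
  then have R: "1 < R" using \<alpha> assms(4) by simp
  have aR: "\<alpha> * R = 1 - exp (- 1 / \<rho> - 1)" using \<alpha> assms(4) by simp
  have map: "\<phi> z \<in> nbhd \<gamma>" "0 < Re (1 - of_real \<alpha> * z)" if "z \<in> cball 0 R" for z
    using log_map_in_nbhd[OF \<rho> assms(2) \<alpha> aR, of z] that by (auto simp: \<phi>_def)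
  have hol: "f holomorphic_on nbhd \<gamma>" using f(1) by (rule analytic_imp_holomorphic)
  have "\<phi> holomorphic_on cball 0 R"
    unfolding \<phi>_def using map(2)
    by (intro holomorphic_intros) (meson complex_nonpos_Reals_iff not_le)
  then have g: "g holomorphic_on cball 0 R"
    using holomorphic_on_compose_gen[OF _ hol, of \<phi> "cball 0 R"] map(1)
    unfolding g_def o_def by blast
  have gball: "g holomorphic_on ball 0 R"
    using g by (rule holomorphic_on_subset) auto
  have [simp]: "\<phi> 0 = 0" by (simp add: \<phi>_def)
  \<comment> \<open>This is what \<alpha> is chosen for: the logarithm at \<open>z = 1\<close> is
    \<open>- 1/\<rho>\<close>.\<close>
  have "1 - of_real \<alpha> = complex_of_real (exp (- 1 / \<rho>))" using assms(3) by simp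
  then have "\<phi> 1 = 1"
    using \<rho> by (simp add: \<phi>_def Ln_of_real)
  then have g1: "g 1 = f 1" by (simp add: g_def)
  have "0 \<in> nbhd \<gamma>" using map(1)[of 0] R by simp
  then have c: "(deriv ^^ k) g 0 / fact k = c k" for k
    using higher_deriv_compose_log[OF hol open_nbhd, of "ball 0 R" \<rho> \<alpha> 0 k]
      higher_deriv_pullback[OF hol open_nbhd, of 0 0 \<alpha> \<rho> k] map R
    by (simp add: g_def \<phi>_def c_def)
  have sums: "c sums f 1"
    using holomorphic_power_series[OF gball, of 1] R g1 c by (simp add: c)
  have bound: "cmod (c k) \<le> (1 / R) ^ k" for k
  proof -
    have "cmod ((deriv ^^ k) g 0) \<le> fact k * 1 / R ^ k"
      using gball holomorphic_on_imp_continuous_on[OF g] R map f(2)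
      by (intro Cauchy_inequality) (auto simp: g_def)
    then show ?thesis unfolding c[symmetric] by (simp add: norm_divide field_simps)
  qed
  have geom: "(\<lambda>k. (1 / R) ^ N * (1 / R) ^ k) sums ((1 / R) ^ N * (1 / (1 - 1 / R)))"
    using R by (intro sums_mult geometric_sums) simp
  have tail: "(\<lambda>k. c (k + N)) sums (f 1 - (\<Sum>k<N. c k))"
    using sums by (simp add: sums_iff_shift)
  have "cmod (\<Sum>k. c (k + N)) \<le> (\<Sum>k. (1 / R) ^ N * (1 / R) ^ k)"
    using bound[of "_ + N"] by (intro norm_suminf_le sums_summable[OF geom])
      (simp_all add: power_add mult.commute)
  then show ?thesis
    using sums_unique[OF tail] sums_unique[OF geom] unfolding c_def[symmetric] by simp
qed

section \<open>The program\<close>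

lemma halts_within_Store_Seq:
  assumes "eval x m e (of_nat i)" "eval x m e' v"
    and "halts_within x q (m(a := (m a)(i := v))) \<tau> S"
  shows "halts_within x (Seq (Store a e e') q) m (real (cost e + cost e' + 1) + \<tau>) S"
  by (rule halts_within_Seq[OF halts_within_Store[OF assms(1,2),
        where Q = "\<lambda>m'. m' = m(a := (m a)(i := v))"]]) (simp_all add: assms(3))

lemma eval_scalarI: "m 0 n = u \<Longrightarrow> eval x m (scalar n) u"
  using eval_scalar by blast

abbreviation increment :: "nat \<Rightarrow> com" where
  "increment n \<equiv> assign n (Add (scalar n) (Const 1))"

abbreviation for_below :: "nat \<Rightarrow> nat \<Rightarrow> com \<Rightarrow> com" where
  "for_below i n p \<equiv> While (Add (scalar i) (Const 1)) (scalar n) (Seq p (increment i))"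

text \<open>Guards test only \<open>\<le>\<close>, so \<open>i < n\<close> becomes
  \<open>i + 1 \<le> n\<close>. The guard costs 7 and the increment 6, whence 13 per round and 7 for
  the last test. The body must keep the counter and establish the next invariant for the memory
  after the increment.\<close>

lemma halts_within_for_below:
  assumes body: "\<And>i m. i < n \<Longrightarrow> I i m \<Longrightarrow> halts_within x p m \<tau>
      (\<lambda>m. m 0 c = of_nat i \<and> I (Suc i) (m(0 := (m 0)(c := of_nat (Suc i)))))"
    and inv: "\<And>i m. i \<le> n \<Longrightarrow> I i m \<Longrightarrow> m 0 c = of_nat i \<and> m 0 d = of_nat n"
    and init: "I 0 m"
  shows "halts_within x (for_below c d p) m (real n * (13 + \<tau>) + 7) (I n)"
proof -
  have guard: "\<exists>u v. eval x m (Add (scalar c) (Const 1)) u \<and> eval x m (scalar d) v \<and>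
      (Re u \<le> Re v \<longleftrightarrow> i < n)" if "i \<le> n" "I i m" for i m
    using inv[OF that]
    by (intro exI[of _ "m 0 c + 1"] exI[of _ "m 0 d"] conjI eval.Add eval_scalar eval.Const) auto
  have "halts_within x (for_below c d p) m
    (real n * (real (cost (Add (scalar c) (Const 1)) + cost (scalar d) + 1) + (\<tau> + 6))
      + real (cost (Add (scalar c) (Const 1)) + cost (scalar d) + 1)) (I n)"
  proof (rule halts_within_While[where I = I])
    fix i m assume *: "i < n" "I i m"
    show "halts_within x (Seq p (increment c)) m (\<tau> + 6) (I (Suc i))"
    proof (rule halts_within_Seq[OF body[OF *]])
      fix m assume m: "m 0 c = of_nat i \<and> I (Suc i) (m(0 := (m 0)(c := of_nat (Suc i))))"
      have "eval x m (Add (scalar c) (Const 1)) (m 0 c + 1)"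
        by (intro eval.Add eval_scalar eval.Const)
      then have "eval x m (Add (scalar c) (Const 1)) (of_nat (Suc i))"
        using m by (simp add: add.commute)
      from halts_within_Store[OF eval.Const this, where a = 0 and Q = "I (Suc i)"] m
      show "halts_within x (increment c) m 6 (I (Suc i))" by (simp add: eval_nat_numeral)
    qed
    show "\<exists>u v. eval x m (Add (scalar c) (Const 1)) u \<and> eval x m (scalar d) v \<and> Re u \<le> Re v"
      using guard[of i m] * by (meson less_imp_le)
  next
    fix m assume "I n m"
    then show "\<exists>u v. eval x m (Add (scalar c) (Const 1)) u \<and> eval x m (scalar d) v \<and> \<not> Re u \<le> Re v"
      using guard[of n m] by (meson order_refl less_irrefl)
  qed (rule init)
  then show ?thesis by (rule halts_within_mono) (auto simp: algebra_simps)
qed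

text \<open>The machine has neither logarithm nor rounding, so the number of terms is found by
  multiplying up powers of \<beta> until they fall below
  \<open>\<kappa> * \<epsilon>\<close>.\<close>

definition count_rounds :: "real \<Rightarrow> real \<Rightarrow> com" where
  "count_rounds \<kappa> \<beta> = Seq (assign 3 (Const 1))
    (While (Mul (Const (of_real \<kappa>)) (scalar 0)) (scalar 3)
      (Seq (assign 3 (Mul (scalar 3) (Const (of_real \<beta>)))) (increment 1)))"

lemma count_rounds_correct:
  assumes "\<And>i. i < n \<Longrightarrow> \<kappa> * \<epsilon> \<le> \<beta> ^ i" "\<beta> ^ n < \<kappa> * \<epsilon>"
  shows "halts_within x (count_rounds \<kappa> \<beta>) (init [of_real \<epsilon>]) (19 * real n + 10)
    (\<lambda>m. m 0 0 = of_real \<epsilon> \<and> m 0 1 = of_nat n \<and> m 0 2 = 0 \<and> m 0 4 = 0 \<and> (\<forall>a i. m (Suc a) i = 0))"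
proof -
  define I where "I i m \<longleftrightarrow> m 0 0 = complex_of_real \<epsilon> \<and> m 0 1 = of_nat i \<and> m 0 2 = 0 \<and> m 0 4 = 0
    \<and> (\<forall>a i. m (Suc a) i = 0) \<and> m 0 3 = of_real (\<beta> ^ i)" for i :: nat and m :: memory
  have guard: "\<exists>u v. eval x m (Mul (Const (of_real \<kappa>)) (scalar 0)) u \<and> eval x m (scalar 3) v \<and>
      (Re u \<le> Re v \<longleftrightarrow> \<kappa> * \<epsilon> \<le> \<beta> ^ i)" if "I i m" for i m
    using that unfolding I_def
    by (intro exI[of _ "of_real \<kappa> * m 0 0"] exI[of _ "m 0 3"] conjI eval.Mul eval_scalar eval.Const)
      (auto simp flip: of_real_power)
  show ?thesis unfolding count_rounds_def
  proof (rule halts_within_mono[OF halts_within_Store_Seq[OF eval.Const eval.Const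
          halts_within_While[where I = I and n = n and \<tau> = 12]]])
    fix i m assume "i < n" "I i m"
    then show "\<exists>u v. eval x m (Mul (Const (of_real \<kappa>)) (scalar 0)) u \<and> eval x m (scalar 3) v \<and> Re u \<le> Re v"
      using guard assms(1) by meson
    show "halts_within x (Seq (assign 3 (Mul (scalar 3) (Const (of_real \<beta>)))) (increment 1)) m 12 (I (Suc i))"
      by (rule halts_within_mono[OF halts_within_Store_Seq[OF eval.Const
              eval.Mul[OF eval_scalar eval.Const] halts_within_Store[OF eval.Const
              eval.Add[OF eval_scalar eval.Const], where Q = "I (Suc i)"]]])
        (use \<open>I i m\<close> in \<open>auto simp: I_def\<close>)
  next
    fix m assume "I n m"
    then show "\<exists>u v. eval x m (Mul (Const (of_real \<kappa>)) (scalar 0)) u \<and> eval x m (scalar 3) v \<and> \<not> Re u \<le> Re v"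
      using guard assms(2) by (meson not_le)
  qed (auto simp: I_def init_def)
qed

text \<open>Round \<open>k\<close> puts \<epsilon> and \<open>k\<close> into cells \<open>k\<close>
  and \<open>n + k\<close> of array 1, the images of the argument cells 0 and 1 of array 0. Its
  result appears in cell \<open>(1, k)\<close>, the image of \<open>(0, 0)\<close>, so the results
  line up at the start of array 1.\<close>

definition tabulate :: "com \<Rightarrow> com" where
  "tabulate P = for_below 2 1 (Seq (Store 1 (scalar 2) (scalar 0))
     (Seq (Store 1 (Add (scalar 1) (scalar 2)) (scalar 2)) (spread_com P)))"

lemma tabulate_correct:
  assumes P: "\<And>j. j < n \<Longrightarrow> approximates_in_time P x [\<epsilon>, of_nat j] (w j) \<delta> T"
    and m: "m 0 0 = \<epsilon>" "m 0 1 = of_nat n" "m 0 2 = 0" "m 0 4 = 0" "\<And>a i. m (Suc a) i = 0"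
  shows "halts_within x (tabulate P) m (real n * (26 + 7 * T) + 7)
    (\<lambda>m. m 0 1 = of_nat n \<and> m 0 4 = 0 \<and> (\<forall>j<n. cmod (m 1 j - w j) \<le> \<delta>))"
proof -
  \<comment> \<open>Residues from \<open>k\<close> on are still blank, because each earlier round
    writes only to its own residue.\<close>
  define I where "I k m \<longleftrightarrow> m 0 0 = \<epsilon> \<and> m 0 1 = of_nat n \<and> m 0 2 = of_nat k \<and> m 0 4 = 0
    \<and> (\<forall>a i. k \<le> i mod n \<longrightarrow> m (Suc a) i = 0) \<and> (\<forall>j<k. cmod (m (Suc 0) j - w j) \<le> \<delta>)"
    for k :: nat and m :: memory
  have "halts_within x (tabulate P) m (real n * (13 + (5 + (8 + 7 * T))) + 7) (I n)"
    unfolding tabulate_def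
  proof (rule halts_within_for_below)
    fix k m assume k: "k < n" and I: "I k m"
    define m1 where "m1 = m(1 := (m 1)(k := \<epsilon>))"
    define m2 where "m2 = m1(1 := (m1 1)(n + k := of_nat k))"
    have round: "holds_round n k (init [\<epsilon>, of_nat k]) m2"
      unfolding holds_round_def
    proof (intro conjI allI)
      fix a i
      have "m (Suc a) (i * n + k) = 0" using I k by (simp add: I_def)
      moreover have "n + k = i * n + k \<longleftrightarrow> i = 1" "k = i * n + k \<longleftrightarrow> i = 0" using k by auto
      ultimately show "m2 (Suc a) (i * n + k) = init [\<epsilon>, of_nat k] a i"
        using k by (auto simp: m1_def m2_def init_def nth_Cons split: nat.splits)
    qed (use I k in \<open>auto simp: I_def m1_def m2_def\<close>)
    obtain t m' where 1: "exec x P (init [\<epsilon>, of_nat k]) t m'" "cmod (m' 0 0 - w k) \<le> \<delta>" "real t \<le> T"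
      using P[OF k] unfolding approximates_in_time_def by blast
    obtain t' M where 2: "exec x (spread_com P) m2 t' M" "t' \<le> 7 * t" "holds_round n k m' M"
      "\<And>a i. a = 0 \<or> i mod n \<noteq> k \<Longrightarrow> M a i = m2 a i"
      using exec_spread_com[OF 1(1) round] by blast
    have M1: "M (Suc 0) k = m' 0 0"
      using 2(3) unfolding holds_round_def by (metis add_0 mult_0)
    have same: "M a i = m a i" if "a = 0 \<or> i mod n \<noteq> k" for a i
      using that k 2(4)[OF that] by (auto simp: m1_def m2_def)
    have post: "M 0 2 = of_nat k \<and> I (Suc k) (M(0 := (M 0)(2 := of_nat (Suc k))))"
      using I k M1 1(2) same by (auto simp: I_def less_Suc_eq Suc_le_eq)
    have "halts_within x (spread_com P) m2 (7 * T)
        (\<lambda>m. m 0 2 = of_nat k \<and> I (Suc k) (m(0 := (m 0)(2 := of_nat (Suc k)))))"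
      unfolding halts_within_def using 1(3) 2(1,2) post by (intro exI[of _ t'] exI[of _ M]) simp
    then have *: "halts_within x (Seq (Store 1 (Add (scalar 1) (scalar 2)) (scalar 2)) (spread_com P)) m1
        (real (cost (Add (scalar 1) (scalar 2)) + cost (scalar 2) + 1) + 7 * T)
        (\<lambda>m. m 0 2 = of_nat k \<and> I (Suc k) (m(0 := (m 0)(2 := of_nat (Suc k)))))"
      unfolding m2_def
    proof (rule halts_within_Store_Seq[rotated 2])
      have "eval x m1 (Add (scalar 1) (scalar 2)) (m1 0 1 + m1 0 2)"
        by (intro eval.Add eval_scalar)
      then show "eval x m1 (Add (scalar 1) (scalar 2)) (of_nat (n + k))"
        using I by (simp add: I_def m1_def)
      show "eval x m1 (scalar 2) (of_nat k)"
        using I by (intro eval_scalarI) (simp add: I_def m1_def)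
    qed
    have "halts_within x (Seq (Store 1 (scalar 2) (scalar 0))
        (Seq (Store 1 (Add (scalar 1) (scalar 2)) (scalar 2)) (spread_com P))) m
        (real (cost (scalar 2) + cost (scalar 0) + 1)
          + (real (cost (Add (scalar 1) (scalar 2)) + cost (scalar 2) + 1) + 7 * T))
        (\<lambda>m. m 0 2 = of_nat k \<and> I (Suc k) (m(0 := (m 0)(2 := of_nat (Suc k)))))"
      by (rule halts_within_Store_Seq[OF eval_scalarI eval_scalarI *[unfolded m1_def]])
        (use I in \<open>auto simp: I_def\<close>)
    then show "halts_within x (Seq (Store 1 (scalar 2) (scalar 0))
        (Seq (Store 1 (Add (scalar 1) (scalar 2)) (scalar 2)) (spread_com P))) m (5 + (8 + 7 * T))
        (\<lambda>m. m 0 2 = of_nat k \<and> I (Suc k) (m(0 := (m 0)(2 := of_nat (Suc k)))))"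
      by (rule halts_within_mono) auto
  qed (use m in \<open>auto simp: I_def\<close>)
  then show ?thesis by (rule halts_within_mono) (auto simp: I_def)
qed

section \<open>In-place evaluation of the recurrence\<close>

definition transform_step :: "real \<Rightarrow> real \<Rightarrow> exp" where
  "transform_step \<alpha> \<rho> = Div (Mul (Const (of_real \<alpha>))
     (Add (Mul (Mul (Const (of_real \<rho>)) (Add (scalar 2) (Const 1))) (Arr 1 (Add (scalar 2) (Const 1))))
       (Mul (scalar 4) (Arr 1 (scalar 2))))) (Add (scalar 4) (Const 1))"

definition transform_sum :: "real \<Rightarrow> real \<Rightarrow> com" where
  "transform_sum \<alpha> \<rho> = Seq (assign 3 (Const 0)) (Seq
     (for_below 4 1 (Seq (assign 3 (Add (scalar 3) (Arr 1 (Const 0)))) (Seq (assign 2 (Const 0))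
       (for_below 2 1 (Store 1 (scalar 2) (transform_step \<alpha> \<rho>))))))
     (assign 0 (scalar 3)))"

lemma eval_transform_step:
  assumes "m 0 2 = of_nat j" "m 0 4 = of_nat k"
  shows "eval x m (transform_step \<alpha> \<rho>)
    (of_real \<alpha> * (of_real \<rho> * of_nat (Suc j) * m 1 (Suc j) + of_nat k * m 1 j) / of_nat (Suc k))"
proof -
  have suc: "eval x m (Add (scalar i) (Const 1)) (of_nat (Suc l))" if "m 0 i = of_nat l" for i l
    using eval.Add[OF eval_scalar eval.Const, of x m i 1] that by (simp add: add.commute)
  show ?thesis unfolding transform_step_def
    by (intro eval.Div eval.Mul eval.Add eval.Const eval.Arr suc eval_scalarI assms) (simp del: of_nat_Suc)
qed

text \<open>The rows of the table of \<^const>\<open>transformed_coeff\<close> are computed in place. Row \<open>k\<close> is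
  correct only up to column \<open>n - 1 - k\<close>; the entries to the right of it depend on the unknown
  coefficients from \<open>n\<close> on, but do not influence the first column.\<close>

lemma transform_sum_correct:
  assumes m: "m 0 1 = of_nat n" "m 0 4 = 0"
  shows "halts_within x (transform_sum \<alpha> \<rho>) m (42 * real n ^ 2 + 30 * real n + 14)
    (\<lambda>m'. m' 0 0 = (\<Sum>k<n. transformed_coeff \<alpha> \<rho> (m 1) k 0))"
proof -
  define H where "H = transformed_coeff \<alpha> \<rho> (m 1)"
  define I where "I k m \<longleftrightarrow> m 0 1 = of_nat n \<and> m 0 4 = of_nat k \<and> m 0 3 = (\<Sum>k<k. H k 0)
    \<and> (\<forall>j. j + k < n \<longrightarrow> m 1 j = H k j)" for k :: nat and m :: memory
  \<comment> \<open>Columns left of \<open>i\<close> already hold row \<open>k + 1\<close>, the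
    others still row \<open>k\<close>. Going from left to right is safe, since a new entry needs
    only the old entries in its own column and the next. Cell 3 already includes row
    \<open>k\<close>.\<close>
  define J where "J k i m \<longleftrightarrow> m 0 1 = of_nat n \<and> m 0 2 = of_nat i \<and> m 0 4 = of_nat k
    \<and> m 0 3 = (\<Sum>k<Suc k. H k 0) \<and> (\<forall>j. j < i \<longrightarrow> Suc j + k < n \<longrightarrow> m 1 j = H (Suc k) j)
    \<and> (\<forall>j\<ge>i. j + k < n \<longrightarrow> m 1 j = H k j)" for k i :: nat and m :: memory
  have inner: "halts_within x (for_below 2 1 (Store 1 (scalar 2) (transform_step \<alpha> \<rho>))) m
      (real n * (13 + 29) + 7) (J k n)" if "J k 0 m" for k m
  proof (rule halts_within_for_below)
    fix i m assume i: "i < n" and J: "J k i m"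
    let ?v = "of_real \<alpha> * (of_real \<rho> * of_nat (Suc i) * m 1 (Suc i) + of_nat k * m 1 i) / of_nat (Suc k)"
    \<comment> \<open>The condition is exactly that the old entry in column \<open>i + 1\<close> is
      known to be correct.\<close>
    have "?v = H (Suc k) i" if "Suc i + k < n"
      using J that unfolding J_def H_def by simp
    then have post: "(m(1 := (m 1)(i := ?v))) 0 2 = of_nat i \<and>
        J k (Suc i) ((m(1 := (m 1)(i := ?v)))(0 := ((m(1 := (m 1)(i := ?v))) 0)(2 := of_nat (Suc i))))"
      using J unfolding J_def by (auto simp: less_Suc_eq)
    have "halts_within x (Store 1 (scalar 2) (transform_step \<alpha> \<rho>)) m
       (real (cost (scalar 2) + cost (transform_step \<alpha> \<rho>) + 1))
       (\<lambda>m. m 0 2 = of_nat i \<and> J k (Suc i) (m(0 := (m 0)(2 := of_nat (Suc i)))))"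
    proof (rule halts_within_Store)
      show "eval x m (scalar 2) (of_nat i)" using J by (intro eval_scalarI) (simp add: J_def)
      show "eval x m (transform_step \<alpha> \<rho>) ?v" using J by (intro eval_transform_step) (simp_all add: J_def)
    qed (rule post)
    then show "halts_within x (Store 1 (scalar 2) (transform_step \<alpha> \<rho>)) m 29
       (\<lambda>m. m 0 2 = of_nat i \<and> J k (Suc i) (m(0 := (m 0)(2 := of_nat (Suc i)))))"
      by (rule halts_within_mono) (auto simp: transform_step_def)
  qed (use that in \<open>auto simp: J_def\<close>)
  have outer: "halts_within x (for_below 4 1 (Seq (assign 3 (Add (scalar 3) (Arr 1 (Const 0))))
      (Seq (assign 2 (Const 0)) (for_below 2 1 (Store 1 (scalar 2) (transform_step \<alpha> \<rho>)))))) m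
      (real n * (13 + (7 + (3 + (real n * (13 + 29) + 7)))) + 7) (I n)" if "I 0 m" for m
  proof (rule halts_within_for_below)
    fix k m assume k: "k < n" and I: "I k m"
    \<comment> \<open>The first entry of row \<open>k\<close> joins the sum before the row is
      overwritten.\<close>
    define m1 where "m1 = m(0 := (m 0)(3 := m 0 3 + m 1 0))"
    define m2 where "m2 = m1(0 := (m1 0)(2 := 0))"
    have "J k 0 m2" using I k by (auto simp: I_def J_def m1_def m2_def)
    from halts_within_mono[OF inner[OF this] order_refl]
    have "halts_within x (for_below 2 1 (Store 1 (scalar 2) (transform_step \<alpha> \<rho>))) m2
        (real n * (13 + 29) + 7) (\<lambda>m. m 0 4 = of_nat k \<and> I (Suc k) (m(0 := (m 0)(4 := of_nat (Suc k)))))"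
      by (auto simp: I_def J_def)
    from halts_within_Store_Seq[OF eval.Const eval.Const this[unfolded m2_def]]
    have "halts_within x (Seq (assign 2 (Const 0)) (for_below 2 1 (Store 1 (scalar 2) (transform_step \<alpha> \<rho>)))) m1
        (real (cost (Const (of_nat 2)) + cost (Const 0) + 1) + (real n * (13 + 29) + 7))
        (\<lambda>m. m 0 4 = of_nat k \<and> I (Suc k) (m(0 := (m 0)(4 := of_nat (Suc k)))))" .
    note 2 = halts_within_Store_Seq[OF eval.Const eval.Add[OF eval_scalar eval.Arr[where i = 0]] this[unfolded m1_def]]
    have "eval x m (Const 0) (of_nat 0)" by (intro eval_ConstI) simp
    from halts_within_mono[OF 2[OF this]]
    show "halts_within x (Seq (assign 3 (Add (scalar 3) (Arr 1 (Const 0)))) (Seq (assign 2 (Const 0))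
       (for_below 2 1 (Store 1 (scalar 2) (transform_step \<alpha> \<rho>))))) m
       (7 + (3 + (real n * (13 + 29) + 7)))
       (\<lambda>m. m 0 4 = of_nat k \<and> I (Suc k) (m(0 := (m 0)(4 := of_nat (Suc k)))))"
      by simp
  qed (use that in \<open>auto simp: I_def\<close>)
  have "I 0 (m(0 := (m 0)(3 := 0)))" using m by (auto simp: I_def H_def)
  note 1 = outer[OF this]
  have 2: "halts_within x (assign 0 (scalar 3)) m' (real (cost (Const (of_nat 0)) + cost (scalar 3) + 1))
      (\<lambda>m'. m' 0 0 = (\<Sum>k<n. H k 0))" if "I n m'" for m'
    using that by (intro halts_within_Store[OF eval.Const eval_scalar]) (auto simp: I_def)
  show ?thesis unfolding transform_sum_def H_def[symmetric]
    by (rule halts_within_mono[OF halts_within_Store_Seq[OF eval.Const eval.Const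
          halts_within_Seq[OF 1 2]]]) (auto simp: algebra_simps power2_eq_square)
qed

text \<open>The least \<open>n\<close> with \<open>\<beta>^n < \<kappa> * \<epsilon>\<close> exceeds
  \<open>ln (1 / (\<kappa> * \<epsilon>)) / ln (1 / \<beta>)\<close> by at most 1. Additive
  constants are absorbed through \<open>ln 2 \<le> ln (1 / \<epsilon>)\<close>, hence the division
  by \<open>ln 2\<close> in \<open>A\<close>.\<close>

lemma exists_number_of_rounds:
  fixes \<beta> \<kappa> :: real
  assumes "0 < \<beta>" "\<beta> < 1" "0 < \<kappa>" "\<kappa> < 1"
  shows "\<exists>A>0. \<forall>\<epsilon>. 0 < \<epsilon> \<and> \<epsilon> < 1/2 \<longrightarrow>
    (\<exists>n>0. (\<forall>i<n. \<kappa> * \<epsilon> \<le> \<beta> ^ i) \<and> \<beta> ^ n < \<kappa> * \<epsilon> \<and> real n \<le> A * ln (1 / \<epsilon>))"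
proof -
  define A where "A = (1 + (ln (1 / \<kappa>) / ln (1 / \<beta>))) / ln 2 + 1 / ln (1 / \<beta>)"
  have pos: "0 < ln (1 / \<beta>)" "0 < ln (1 / \<kappa>)" using assms by simp_all
  then have A: "0 < A" unfolding A_def by (intro add_pos_pos divide_pos_pos) auto
  show ?thesis
  proof (intro exI[of _ A] conjI allI impI A)
    fix \<epsilon> :: real assume \<epsilon>: "0 < \<epsilon> \<and> \<epsilon> < 1/2"
    define n where "n = (LEAST n. \<beta> ^ n < \<kappa> * \<epsilon>)"
    have "\<exists>n. \<beta> ^ n < \<kappa> * \<epsilon>" using assms \<epsilon> by (intro real_arch_pow_inv) auto
    then have n: "\<beta> ^ n < \<kappa> * \<epsilon>" unfolding n_def by (rule LeastI_ex)
    have less: "\<kappa> * \<epsilon> \<le> \<beta> ^ i" if "i < n" for i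
      using not_less_Least[of i "\<lambda>n. \<beta> ^ n < \<kappa> * \<epsilon>"] that unfolding n_def by auto
    \<comment> \<open>This excludes \<open>n = 0\<close>, where the power is 1, so that minimality
      can be applied to \<open>n - 1\<close>.\<close>
    have "\<kappa> * \<epsilon> < 1 * 1" using assms \<epsilon> by (intro mult_strict_mono) auto
    then have n0: "n > 0" using n by (cases n) auto
    have "\<kappa> * \<epsilon> \<le> \<beta> ^ (n - 1)" using less n0 by simp
    then have "ln (\<kappa> * \<epsilon>) \<le> ln (\<beta> ^ (n - 1))" using assms \<epsilon> by simp
    then have "real (n - 1) * ln (1 / \<beta>) \<le> ln (1 / \<kappa>) + ln (1 / \<epsilon>)"
      using assms \<epsilon> by (simp add: ln_realpow ln_mult ln_div)
    then have "real (n - 1) \<le> (ln (1 / \<kappa>) + ln (1 / \<epsilon>)) / ln (1 / \<beta>)"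
      using pos by (simp add: pos_le_divide_eq)
    then have 1: "real n \<le> (1 + ln (1 / \<kappa>) / ln (1 / \<beta>)) * 1 + ln (1 / \<epsilon>) / ln (1 / \<beta>)"
      using n0 by (simp add: add_divide_distrib of_nat_diff)
    have "2 \<le> 1 / \<epsilon>" using \<epsilon> by (simp add: field_simps)
    then have "1 \<le> ln (1 / \<epsilon>) / ln 2" using \<epsilon> by simp
    then have "(1 + ln (1 / \<kappa>) / ln (1 / \<beta>)) * 1
        \<le> (1 + ln (1 / \<kappa>) / ln (1 / \<beta>)) * (ln (1 / \<epsilon>) / ln 2)"
      using pos by (intro mult_left_mono add_nonneg_nonneg divide_nonneg_nonneg) auto
    also have "\<dots> + ln (1 / \<epsilon>) / ln (1 / \<beta>) = A * ln (1 / \<epsilon>)"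
      by (simp only: A_def distrib_right times_divide_eq_left times_divide_eq_right mult_1)
    finally have "real n \<le> A * ln (1 / \<epsilon>)" using 1 by simp
    then show "\<exists>n>0. (\<forall>i<n. \<kappa> * \<epsilon> \<le> \<beta> ^ i) \<and> \<beta> ^ n < \<kappa> * \<epsilon> \<and> real n \<le> A * ln (1 / \<epsilon>)"
      using n0 n less by blast
  qed
qed

theorem theorem3p1:
  fixes \<gamma> :: real
  assumes "0 < \<gamma>" and "\<gamma> < 1"
  shows "\<exists>C::real. C > 0 \<and>
    (\<forall>P::com. \<exists>Q::com. \<forall>(x::complex list) (\<epsilon>::real) (f::complex \<Rightarrow> complex) (T::real).
       0 < \<epsilon> \<and> \<epsilon> < 1/2 \<and> f analytic_on nbhd \<gamma> \<and> (\<forall>z\<in>nbhd \<gamma>. cmod (f z) \<le> 1) \<and>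
       (\<forall>j::nat. real j \<le> C * ln (1/\<epsilon>) \<longrightarrow>
          approximates_in_time P x [complex_of_real \<epsilon>, of_nat j]
            ((deriv ^^ j) f 0 / fact j) (\<epsilon> powr C) T)
       \<longrightarrow> approximates_in_time Q x [complex_of_real \<epsilon>] (f 1) \<epsilon>
             (C * T * ln (1/\<epsilon>) + ln (1/\<epsilon>) powr C))"
proof -
  define \<rho> where "\<rho> = \<gamma> / 4"
  define \<alpha> where "\<alpha> = 1 - exp (- 1 / \<rho>)"
  define R where "R = (1 - exp (- 1 / \<rho> - 1)) / \<alpha>"
  \<comment> \<open>With this factor, stopping once \<open>(1 / R)^n < \<kappa> * \<epsilon>\<close>
    leaves a truncation error of at most \<open>\<epsilon> / 2\<close>.\<close>
  define \<kappa> where "\<kappa> = (1 - 1 / R) / 2"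
  have \<rho>: "0 < \<rho>" "\<rho> \<le> 1" using assms by (simp_all add: \<rho>_def)
  have \<alpha>: "0 < \<alpha>" "\<alpha> \<le> 1" using \<rho> by (simp_all add: \<alpha>_def)
  have "\<alpha> < 1 - exp (- 1 / \<rho> - 1)" by (simp add: \<alpha>_def)
  then have R: "1 < R" using \<alpha> by (simp add: R_def)
  then have \<kappa>: "0 < \<kappa>" "\<kappa> < 1" by (simp_all add: \<kappa>_def field_simps)
  obtain A where A: "0 < A" and rounds: "\<And>\<epsilon>. 0 < \<epsilon> \<Longrightarrow> \<epsilon> < 1/2 \<Longrightarrow>
      \<exists>n>0. (\<forall>i<n. \<kappa> * \<epsilon> \<le> (1 / R) ^ i) \<and> (1 / R) ^ n < \<kappa> * \<epsilon> \<and> real n \<le> A * ln (1 / \<epsilon>)"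
    using exists_number_of_rounds[of "1 / R" \<kappa>] R \<kappa> by auto
  \<comment> \<open>The part \<open>2 + A * ln 4\<close> makes the input precision outweigh the
    error amplification; the other summands pay for the running time. Moreover
    \<open>A \<le> C\<close>, so the hypothesis covers every coefficient that is computed.\<close>
  define C where "C = 2 + A * ln 4 + 113 * A + 126 * A\<^sup>2"
  have C: "0 < C" "A \<le> C" "113 * A + 126 * A\<^sup>2 \<le> C" "2 + 42 * A\<^sup>2 \<le> C" "2 + A * ln 4 \<le> C"
    using A by (auto simp: C_def add_pos_nonneg)
  show ?thesis
  proof (intro exI[of _ C] conjI allI exI impI, rule C(1))
    fix P :: com and x :: "complex list" and \<epsilon> T :: real and f :: "complex \<Rightarrow> complex"
    assume *: "0 < \<epsilon> \<and> \<epsilon> < 1/2 \<and> f analytic_on nbhd \<gamma> \<and> (\<forall>z\<in>nbhd \<gamma>. cmod (f z) \<le> 1) \<and>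
       (\<forall>j::nat. real j \<le> C * ln (1/\<epsilon>) \<longrightarrow>
          approximates_in_time P x [complex_of_real \<epsilon>, of_nat j]
            ((deriv ^^ j) f 0 / fact j) (\<epsilon> powr C) T)"
    define a where "a j = (deriv ^^ j) f 0 / fact j" for j
    define L where "L = ln (1 / \<epsilon>)"
    have \<epsilon>: "0 < \<epsilon>" "\<epsilon> < 1/2" using * by auto
    have L: "0 < L" using \<epsilon> by (simp add: L_def)
    obtain n where n: "0 < n" "\<And>i. i < n \<Longrightarrow> \<kappa> * \<epsilon> \<le> (1 / R) ^ i" "(1 / R) ^ n < \<kappa> * \<epsilon>"
        "real n \<le> A * L"
      using rounds[OF \<epsilon>] unfolding L_def by blast
    have P: "approximates_in_time P x [of_real \<epsilon>, of_nat j] (a j) (\<epsilon> powr C) T" if "j < n" for j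
    proof -
      have "real j \<le> A * L" using n(4) that by simp
      also have "\<dots> \<le> C * L" using C(2) L by simp
      finally show ?thesis using * by (simp add: a_def L_def)
    qed
    \<comment> \<open>Every run takes at least one unit and at least one coefficient is computed, so
      costs free of \<open>T\<close> can be charged to \<open>n * T\<close>.\<close>
    have T: "1 \<le> T"
    proof -
      have "1 \<le> t" if "exec x p m t m'" for p m t m'
        using that by induction auto
      then show ?thesis
        using P[OF n(1)] unfolding approximates_in_time_def by fastforce
    qed
    \<comment> \<open>The program is built from \<open>P\<close> and constants determined by
      \<gamma>; \<epsilon> reaches it only as an argument.\<close>
    let ?Q = "Seq (count_rounds \<kappa> (1 / R)) (Seq (tabulate P) (transform_sum \<alpha> \<rho>))"
    have run: "halts_within x ?Q (init [of_real \<epsilon>])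
      ((19 * real n + 10) + ((real n * (26 + 7 * T) + 7) + (42 * real n ^ 2 + 30 * real n + 14)))
      (\<lambda>m'. \<exists>b. (\<forall>j<n. cmod (b j - a j) \<le> \<epsilon> powr C) \<and> m' 0 0 = (\<Sum>k<n. transformed_coeff \<alpha> \<rho> b k 0))"
    proof (intro halts_within_Seq)
      show "halts_within x (count_rounds \<kappa> (1 / R)) (init [of_real \<epsilon>]) (19 * real n + 10)
        (\<lambda>m. m 0 0 = of_real \<epsilon> \<and> m 0 1 = of_nat n \<and> m 0 2 = 0 \<and> m 0 4 = 0 \<and> (\<forall>a i. m (Suc a) i = 0))"
        using n by (intro count_rounds_correct)
      show "halts_within x (tabulate P) m (real n * (26 + 7 * T) + 7)
          (\<lambda>m. m 0 1 = of_nat n \<and> m 0 4 = 0 \<and> (\<forall>j<n. cmod (m 1 j - a j) \<le> \<epsilon> powr C))"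
        if "m 0 0 = of_real \<epsilon> \<and> m 0 1 = of_nat n \<and> m 0 2 = 0 \<and> m 0 4 = 0 \<and> (\<forall>a i. m (Suc a) i = 0)" for m
        using that P by (intro tabulate_correct) auto
      show "halts_within x (transform_sum \<alpha> \<rho>) m (42 * real n ^ 2 + 30 * real n + 14)
          (\<lambda>m'. \<exists>b. (\<forall>j<n. cmod (b j - a j) \<le> \<epsilon> powr C) \<and> m' 0 0 = (\<Sum>k<n. transformed_coeff \<alpha> \<rho> b k 0))"
        if "m 0 1 = of_nat n \<and> m 0 4 = 0 \<and> (\<forall>j<n. cmod (m 1 j - a j) \<le> \<epsilon> powr C)" for m
        using that by (intro halts_within_mono[OF transform_sum_correct order_refl]) auto
    qed
    have error: "cmod ((\<Sum>k<n. transformed_coeff \<alpha> \<rho> b k 0) - f 1) \<le> \<epsilon>"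
      if b: "\<forall>j<n. cmod (b j - a j) \<le> \<epsilon> powr C" for b
    proof -
      have "cmod ((\<Sum>k<n. transformed_coeff \<alpha> \<rho> b k 0) - (\<Sum>k<n. transformed_coeff \<alpha> \<rho> a k 0))
        \<le> (\<Sum>k<n. \<epsilon> powr C * (1 + \<rho>) ^ k)"
        unfolding sum_subtractf[symmetric]
      proof (intro sum_norm_le)
        fix k assume "k \<in> {..<n}"
        then show "cmod (transformed_coeff \<alpha> \<rho> b k 0 - transformed_coeff \<alpha> \<rho> a k 0) \<le> \<epsilon> powr C * (1 + \<rho>) ^ k"
          using transformed_coeff_perturb[of \<alpha> \<rho> "\<epsilon> powr C" k 0 b a] \<alpha> \<rho> b by auto
      qed
      also have "\<dots> \<le> (\<Sum>k<n. \<epsilon> powr C * 2 ^ n)"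
      proof (intro sum_mono mult_left_mono)
        fix k assume "k \<in> {..<n}"
        then have "(1 + \<rho>) ^ k \<le> 2 ^ k" "2 ^ k \<le> (2::real) ^ n"
          using \<rho> by (auto intro!: power_mono power_increasing)
        then show "(1 + \<rho>) ^ k \<le> 2 ^ n" by linarith
      qed simp
      also have "\<dots> = real n * 2 ^ n * \<epsilon> powr C" by simp
      \<comment> \<open>By \<open>n \<le> 2^n\<close> the total amplification is at most
        \<open>4^n\<close>, a fixed power of \<open>1 / \<epsilon>\<close>.\<close>
      also have "\<dots> \<le> (2 ^ n * 2 ^ n) * \<epsilon> powr C"
        by (intro mult_right_mono) (auto intro: less_imp_le)
      also have "2 ^ n * 2 ^ n = (4::real) ^ n"
        by (simp flip: power_mult_distrib)
      also have "(4::real) ^ n = exp (real n * ln 4)"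
        by (simp add: exp_of_nat_mult)
      also have "\<epsilon> powr C = exp (- C * L)"
        using \<epsilon> by (simp add: powr_def L_def ln_div)
      also have "exp (real n * ln 4) * exp (- C * L) = exp (real n * ln 4 - C * L)"
        by (simp flip: exp_add)
      also have "\<dots> \<le> exp (- 2 * L)"
      proof -
        have "real n * ln 4 \<le> A * L * ln 4" using n(4) by (intro mult_right_mono) auto
        moreover have "(2 + A * ln 4) * L \<le> C * L" using C(5) L by simp
        moreover have "(2 + A * ln 4) * L = 2 * L + A * L * ln 4" by (simp add: algebra_simps)
        ultimately show ?thesis unfolding exp_le_cancel_iff by linarith
      qed
      also have "\<dots> = \<epsilon> * \<epsilon>"
        using \<epsilon> by (simp add: L_def ln_div exp_double power2_eq_square)
      also have "\<dots> \<le> \<epsilon> / 2" using \<epsilon> mult_left_mono[of \<epsilon> "1/2" \<epsilon>] by simp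
      finally have 1: "cmod ((\<Sum>k<n. transformed_coeff \<alpha> \<rho> b k 0) - (\<Sum>k<n. transformed_coeff \<alpha> \<rho> a k 0)) \<le> \<epsilon> / 2" .
      have "cmod (f 1 - (\<Sum>k<n. transformed_coeff \<alpha> \<rho> a k 0)) \<le> (1 / R) ^ n / (1 - 1 / R)"
        unfolding a_def using * assms
        by (intro truncated_transform_error[of \<gamma>]) (auto simp: \<rho>_def \<alpha>_def R_def)
      also have "\<dots> \<le> \<kappa> * \<epsilon> / (1 - 1 / R)"
        using n(3) R by (intro divide_right_mono) auto
      also have "1 - 1 / R = 2 * \<kappa>" by (simp add: \<kappa>_def)
      also have "\<kappa> * \<epsilon> / (2 * \<kappa>) = \<epsilon> / 2" using \<kappa>(1) by simp
      finally show ?thesis using 1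
        using norm_triangle_ineq4[of "(\<Sum>k<n. transformed_coeff \<alpha> \<rho> b k 0) - (\<Sum>k<n. transformed_coeff \<alpha> \<rho> a k 0)"
          "f 1 - (\<Sum>k<n. transformed_coeff \<alpha> \<rho> a k 0)"] by simp
    qed
    have time: "(19 * real n + 10) + ((real n * (26 + 7 * T) + 7) + (42 * real n ^ 2 + 30 * real n + 14))
      \<le> C * T * L + L powr C"
    proof -
      \<comment> \<open>The 113 below is 19 + 26 + 7 + 30 from the terms with a factor
        \<open>n\<close>, plus 10 + 7 + 14 from the constants.\<close>
      have "real n * 1 \<le> real n * T" "1 * 1 \<le> real n * T"
        using T n(1) by (intro mult_left_mono mult_mono; simp)+
      then have "(19 * real n + 10) + ((real n * (26 + 7 * T) + 7) + (42 * real n ^ 2 + 30 * real n + 14))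
        \<le> 113 * (real n * T) + 42 * real n ^ 2"
        by (simp add: algebra_simps)
      also have "\<dots> \<le> 113 * (A * L * T) + 42 * (A * L) ^ 2"
        using n T by (intro add_mono mult_left_mono mult_right_mono power_mono) auto
      also have "\<dots> \<le> C * T * L + L powr C"
      \<comment> \<open>The quadratic term has no factor \<open>T\<close>. For
        \<open>L \<le> 3\<close> it is charged to \<open>T * L\<close>, with 126 = 3 * 42. For
        larger \<open>L\<close> the base exceeds \<open>exp 1\<close>, so
        \<open>L powr (C - 2)\<close> is at least \<open>exp (C - 2)\<close>, which dominates
        \<open>42 * A\<^sup>2\<close>.\<close>
      proof (cases "L \<le> 3")
        case True
        have "L * L \<le> 3 * (T * L)"
          using mult_right_mono[OF True, of L] mult_right_mono[OF T, of L] L by simp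
        then have "113 * (A * L * T) + 42 * (A * L) ^ 2 \<le> (113 * A + 126 * A\<^sup>2) * (T * L)"
          using mult_left_mono[of "L * L" "3 * (T * L)" "42 * A\<^sup>2"]
          by (simp add: algebra_simps power2_eq_square)
        also have "\<dots> \<le> C * (T * L)" using C(3) T L by (intro mult_right_mono) auto
        finally show ?thesis by (simp add: mult.assoc add_increasing2)
      next
        case False
        have "113 * A \<le> C" using C(3) zero_le_power2[of A] by linarith
        then have 1: "113 * (A * L * T) \<le> C * T * L"
          using mult_right_mono[of "113 * A" C "T * L"] T L by (simp add: mult_ac)
        have "42 * A\<^sup>2 \<le> C - 2" using C(4) by simp
        also have "\<dots> \<le> exp (C - 2)"
          using exp_ge_add_one_self[of "C - 2"] by simp
        also have "\<dots> = exp 1 powr (C - 2)" by (simp add: powr_def)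
        also have "\<dots> \<le> L powr (C - 2)"
        proof (rule powr_mono2)
          have "0 \<le> A\<^sup>2" by simp
          then show "0 \<le> C - 2" using C(4) by linarith
          show "exp 1 \<le> L" using False exp_le by linarith
        qed simp
        finally have "42 * A\<^sup>2 * L\<^sup>2 \<le> L powr (C - 2) * L powr 2"
          using L by (intro mult_mono) auto
        then have "42 * (A * L)\<^sup>2 \<le> L powr C"
          by (simp add: power_mult_distrib mult.assoc flip: powr_add)
        then show ?thesis using 1 by simp
      qed
      finally show ?thesis .
    qed
    obtain t m b where t: "exec x ?Q (init [of_real \<epsilon>]) t m"
        "real t \<le> (19 * real n + 10) + ((real n * (26 + 7 * T) + 7) + (42 * real n ^ 2 + 30 * real n + 14))"
      and b: "\<forall>j<n. cmod (b j - a j) \<le> \<epsilon> powr C" "m 0 0 = (\<Sum>k<n. transformed_coeff \<alpha> \<rho> b k 0)"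
      using run unfolding halts_within_def by blast
    have "cmod (m 0 0 - f 1) \<le> \<epsilon>" unfolding b(2) by (rule error[OF b(1)])
    with t(1) order_trans[OF t(2) time]
    show "approximates_in_time ?Q x [of_real \<epsilon>] (f 1) \<epsilon> (C * T * ln (1/\<epsilon>) + ln (1/\<epsilon>) powr C)"
      unfolding approximates_in_time_def L_def by blast
  qed
qed

end
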